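(* Let $n_0\ge 1$ be an integer, and let $f:[n_0,\infty)\to\mathbb{R}$, together with $R,S,m,M$, be as in the context. Suppose that $R'\ge 0$, $S'\ge 0$ and $S\ge 0$ at all points of the open intervals $(k,k+1)$, $k\ge n_0+1$ an integer, and that $$m(x-1)\,m(x-2)\left(R'(x)\,m(x-1)+S'(x)\right)\ \ge\ S(x)\left(R'(x-1)\,M(x-2)+S'(x-1)\right)$$ for all $x\in(k,k+1)$, $k\ge n_0+2$ an integer. Let $n\ge n_0+2$ be an integer and suppose that $f$ is increasing (non-decreasing) on $[n_0,n]$. Then $f'(x)\ge 0$ for all $x\in(n,n+1)$.
   Context: Setting: $R$ and $S$ are real functions that are smooth on all open intervals $(k,k+1)$ for integers $k\ge n_0$. The function $f:[n_0,\infty)\to\mathbb{R}$ is continuous, is an affine linear function on $[n_0,n_0+1]$, and satisfies $$f(x)=R(x)+\frac{S(x)}{f(x-1)}\quad\text{for all } x\ge n_0+1.$$ There are functions $m,M$ on $[n_0,\infty)$ with $0<m(x)\le f(x)\le M(x)$ for all $x\ge n_0$. *)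

theory Defs
  imports "HOL-Analysis.Analysis"
begin

(* C-infinity smoothness. Intended for open sets A, where "at x" is the right filter
   and the iterated derivatives at points of A depend only on the values of g on A. *)
definition smooth_on :: "(real \<Rightarrow> real) \<Rightarrow> real set \<Rightarrow> bool" where
  "smooth_on g A \<longleftrightarrow> (\<forall>j. \<forall>x\<in>A. (deriv ^^ j) g differentiable (at x))"

end

theory Submission
  imports Defs
begin

text \<open>Differentiating the recursion twice, \<open>f' (x - 1) \<le> R' (x - 1) + S' (x - 1) / f (x - 2)\<close> because
  \<open>f' (x - 2) \<ge> 0\<close>, and this upper bound on \<open>f' (x - 1)\<close> is exactly what is needed for
  \<open>f' (x) = R' (x) + S' (x) / f (x - 1) - S (x) f' (x - 1) / f (x - 1)\<^sup>2\<close> to be nonnegative.\<close>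

lemma smooth_on_DERIV:
  assumes "smooth_on g A" "x \<in> A"
  shows "(g has_real_derivative deriv g x) (at x)"
proof -
  have "(deriv ^^ 0) g differentiable (at x)"
    using assms unfolding smooth_on_def by blast
  then show ?thesis
    by (simp add: DERIV_deriv_iff_real_differentiable)
qed

text \<open>The quotient rule applied to the right-hand side of the recursion. Since the recursion
  is only available on part of the line, the derivative is carried over to \<open>f\<close> through
  an open neighbourhood \<open>U\<close> of the point.\<close>

lemma recursion_DERIV:
  fixes f R S :: "real \<Rightarrow> real"
  assumes "open U" "x \<in> U"
    and "\<And>y. y \<in> U \<Longrightarrow> f y = R y + S y / f (y - 1)"
    and "(R has_real_derivative R') (at x)" "(S has_real_derivative S') (at x)"
    and "(f has_real_derivative D) (at (x - 1))" "f (x - 1) \<noteq> 0"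
  shows "(f has_real_derivative R' + (S' * f (x - 1) - S x * D) / (f (x - 1))\<^sup>2) (at x)"
proof -
  have "((\<lambda>y. f (y - 1)) has_real_derivative D) (at x)"
    using DERIV_shift[of f D x "-1"] assms(6) by simp
  then have "((\<lambda>y. R y + S y / f (y - 1)) has_real_derivative
      R' + (S' * f (x - 1) - S x * D) / (f (x - 1))\<^sup>2) (at x)"
    using assms(4,5,7) by (auto intro!: derivative_eq_intros simp: power2_eq_square)
  then show ?thesis
    by (rule has_field_derivative_transform_within_open[OF _ assms(1,2)]) (simp add: assms(3))
qed

text \<open>Smoothness travels from one unit interval to the next: \<open>f\<close> is affine on the
  first one, and the recursion expresses \<open>f\<close> near \<open>x\<close> through its values
  near \<open>x - 1\<close>. Only open intervals are covered, as \<open>f\<close> may have kinks at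
  integers.\<close>

lemma recursion_differentiable:
  fixes f R S :: "real \<Rightarrow> real" and n\<^sub>0 k :: int
  assumes "\<And>k::int. k \<ge> n\<^sub>0 \<Longrightarrow> smooth_on R {of_int k <..< of_int k + 1}"
    and "\<And>k::int. k \<ge> n\<^sub>0 \<Longrightarrow> smooth_on S {of_int k <..< of_int k + 1}"
    and "\<exists>a b. \<forall>x\<in>{of_int n\<^sub>0 .. of_int n\<^sub>0 + 1}. f x = a * x + b"
    and "\<And>x. x \<ge> of_int n\<^sub>0 + 1 \<Longrightarrow> f x = R x + S x / f (x - 1)"
    and "\<And>x. x \<ge> of_int n\<^sub>0 \<Longrightarrow> f x \<noteq> 0"
    and "k \<ge> n\<^sub>0" "x \<in> {of_int k <..< of_int k + 1}"
  shows "f differentiable (at x)"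
  using assms(6,7)
proof (induction k arbitrary: x rule: int_ge_induct)
  case base
  obtain a b where "\<forall>x\<in>{of_int n\<^sub>0 .. of_int n\<^sub>0 + 1}. f x = a * x + b"
    using assms(3) by blast
  moreover have "((\<lambda>x. a * x + b) has_real_derivative a) (at x)"
    by (auto intro!: derivative_eq_intros)
  ultimately have "(f has_real_derivative a) (at x)"
    using has_field_derivative_transform_within_open
      [of "\<lambda>x. a * x + b" a x "{of_int n\<^sub>0 <..< of_int n\<^sub>0 + 1}" f] base
    by auto
  then show ?case
    using real_differentiable_def by blast
next
  case (step k)
  have "f differentiable (at (x - 1))"
    using step.IH[of "x - 1"] step.prems by simp
  then obtain D where D: "(f has_real_derivative D) (at (x - 1))"
    using real_differentiable_def by blast
  have "(R has_real_derivative deriv R x) (at x)" "(S has_real_derivative deriv S x) (at x)"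
    using smooth_on_DERIV[OF assms(1)] smooth_on_DERIV[OF assms(2)] step
    by (meson order_trans zle_add1_eq_le less_imp_le zless_add1_eq)+
  moreover have "f (x - 1) \<noteq> 0"
    using assms(5) step by auto
  \<comment> \<open>Here \<open>x > k + 1\<close> and \<open>k \<ge> n\<^sub>0\<close>, so
    \<open>x\<close> lies strictly beyond \<open>n\<^sub>0 + 1\<close> and the recursion holds in a
    whole neighbourhood of \<open>x\<close>.\<close>
  ultimately show ?case
    using recursion_DERIV[of "{of_int n\<^sub>0 + 1 <..}" x f R S, OF _ _ _ _ _ D] step assms(4)
    by (force simp: real_differentiable_def)
qed

text \<open>Passes from the hypothesis on the bounds \<open>m\<close> and \<open>M\<close> to an
  inequality about \<open>f\<close> itself, with \<open>u\<close> and \<open>v\<close> standing for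
  \<open>f (x - 1)\<close> and \<open>f (x - 2)\<close>. The left side of the hypothesis can only
  shrink when \<open>w\<close> is lowered to \<open>v\<close>, the right side can only grow when
  \<open>m\<^sub>1\<close>, \<open>m\<^sub>2\<close> are raised to \<open>u\<close>,
  \<open>v\<close>; dividing by \<open>v\<close> finishes.\<close>

lemma le_divide_of_lower_bounds:
  fixes m\<^sub>1 m\<^sub>2 :: real
  assumes "0 < m\<^sub>1" "m\<^sub>1 \<le> u" "0 < m\<^sub>2" "m\<^sub>2 \<le> v" "v \<le> w"
    and "0 \<le> r" "0 \<le> s" "0 \<le> t" "0 \<le> r'"
    and "t * (r' * w + s') \<le> m\<^sub>1 * m\<^sub>2 * (r * m\<^sub>1 + s)"
  shows "t * (r' + s' / v) \<le> u * (r * u + s)"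
proof -
  have v: "0 < v"
    using assms by linarith
  have "t * (r' * v + s') \<le> t * (r' * w + s')"
    using assms by (intro mult_left_mono add_right_mono) auto
  also have "\<dots> \<le> m\<^sub>1 * m\<^sub>2 * (r * m\<^sub>1 + s)"
    by fact
  also have "\<dots> \<le> u * v * (r * u + s)"
    using assms by (intro mult_mono add_mono) auto
  finally show ?thesis
    using v by (simp add: field_simps)
qed

theorem theorem4p2:
  fixes n\<^sub>0 n :: int and f R S m M :: "real \<Rightarrow> real"
  assumes "n\<^sub>0 \<ge> 1"
    and "\<And>k::int. k \<ge> n\<^sub>0 \<Longrightarrow> smooth_on R {of_int k <..< of_int k + 1}"
    and "\<And>k::int. k \<ge> n\<^sub>0 \<Longrightarrow> smooth_on S {of_int k <..< of_int k + 1}"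
    and "continuous_on {of_int n\<^sub>0 ..} f"
    and "\<exists>a b. \<forall>x\<in>{of_int n\<^sub>0 .. of_int n\<^sub>0 + 1}. f x = a * x + b"
    and "\<And>x. x \<ge> of_int n\<^sub>0 + 1 \<Longrightarrow> f x = R x + S x / f (x - 1)"
    and "\<And>x. x \<ge> of_int n\<^sub>0 \<Longrightarrow> 0 < m x \<and> m x \<le> f x \<and> f x \<le> M x"
    and "\<And>(k::int) x. k \<ge> n\<^sub>0 + 1 \<Longrightarrow> x \<in> {of_int k <..< of_int k + 1} \<Longrightarrow>
           deriv R x \<ge> 0 \<and> deriv S x \<ge> 0 \<and> S x \<ge> 0"
    and "\<And>(k::int) x. k \<ge> n\<^sub>0 + 2 \<Longrightarrow> x \<in> {of_int k <..< of_int k + 1} \<Longrightarrow>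
           m (x - 1) * m (x - 2) * (deriv R x * m (x - 1) + deriv S x)
             \<ge> S x * (deriv R (x - 1) * M (x - 2) + deriv S (x - 1))"
    and "n \<ge> n\<^sub>0 + 2"
    and "mono_on {of_int n\<^sub>0 .. of_int n} f"
  shows "\<forall>x\<in>{of_int n <..< of_int n + 1}. f differentiable (at x) \<and> deriv f x \<ge> 0"
proof
  fix x :: real
  assume x: "x \<in> {of_int n <..< of_int n + 1}"
  have n: "real_of_int n \<ge> of_int n\<^sub>0 + 2"
    using \<open>n \<ge> n\<^sub>0 + 2\<close> by linarith
  have f_pos: "f y > 0" if "y \<ge> of_int n\<^sub>0" for y
    using assms(7)[OF that] by linarith
  have diff: "f differentiable (at y)" if "k \<ge> n\<^sub>0" "y \<in> {of_int k <..< of_int k + 1}" for k y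
    using recursion_differentiable[OF assms(2,3,5,6) _ that] f_pos by force
  \<comment> \<open>The bound \<open>k \<ge> n\<^sub>0 + 1\<close> places \<open>y - 1\<close> in a
    unit interval where \<open>diff\<close> applies, so that \<open>deriv f (y - 1)\<close> is a
    genuine derivative.\<close>
  have f_DERIV: "(f has_real_derivative deriv R y +
      (deriv S y * f (y - 1) - S y * deriv f (y - 1)) / (f (y - 1))\<^sup>2) (at y)"
    if k: "k \<ge> n\<^sub>0 + 1" and y: "y \<in> {of_int k <..< of_int k + 1}" for k y
  proof (rule recursion_DERIV)
    have k': "real_of_int k \<ge> of_int n\<^sub>0 + 1"
      using k by linarith
    show "y \<in> {of_int n\<^sub>0 + 1 <..}" "f (y - 1) \<noteq> 0"
      using y k' f_pos[of "y - 1"] by auto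
    show "(R has_real_derivative deriv R y) (at y)" "(S has_real_derivative deriv S y) (at y)"
      using smooth_on_DERIV[OF assms(2)[of k] y] smooth_on_DERIV[OF assms(3)[of k] y] k by auto
    show "(f has_real_derivative deriv f (y - 1)) (at (y - 1))"
      using diff[of "k - 1" "y - 1"] k y by (simp add: DERIV_deriv_iff_real_differentiable)
  qed (use assms(6) in auto)
  have deriv_x: "deriv f x = deriv R x +
      (deriv S x * f (x - 1) - S x * deriv f (x - 1)) / (f (x - 1))\<^sup>2"
    using f_DERIV[of n x] x \<open>n \<ge> n\<^sub>0 + 2\<close> by (intro DERIV_imp_deriv) auto
  have deriv_x1: "deriv f (x - 1) = deriv R (x - 1) +
      (deriv S (x - 1) * f (x - 2) - S (x - 1) * deriv f (x - 2)) / (f (x - 2))\<^sup>2"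
    using f_DERIV[of "n - 1" "x - 1"] x \<open>n \<ge> n\<^sub>0 + 2\<close> by (intro DERIV_imp_deriv) auto
  have "(f has_real_derivative deriv f (x - 2)) (at (x - 2))"
    using diff[of "n - 2" "x - 2"] x \<open>n \<ge> n\<^sub>0 + 2\<close>
    by (simp add: DERIV_deriv_iff_real_differentiable)
  \<comment> \<open>The point \<open>x - 2\<close> lies strictly between \<open>n - 2\<close> and
    \<open>n - 1\<close>, hence in the interior of the interval on which \<open>f\<close> is
    monotone.\<close>
  then have x2: "deriv f (x - 2) \<ge> 0"
    using x n by (intro mono_on_imp_deriv_nonneg[OF assms(11)]) auto
  have pos: "f (x - 1) > 0" "f (x - 2) > 0"
    using f_pos x n by auto
  have sgn: "deriv R x \<ge> 0" "deriv S x \<ge> 0" "S x \<ge> 0"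
      "deriv R (x - 1) \<ge> 0" "S (x - 1) \<ge> 0"
    using assms(8)[of n x] assms(8)[of "n - 1" "x - 1"] x \<open>n \<ge> n\<^sub>0 + 2\<close> by auto
  \<comment> \<open>The term dropped from \<open>deriv_x1\<close> is
    \<open>S (x - 1) * deriv f (x - 2) / (f (x - 2))\<^sup>2\<close>, which is nonnegative by
    \<open>x2\<close>.\<close>
  have "deriv f (x - 1) \<le> deriv R (x - 1) + deriv S (x - 1) / f (x - 2)"
    unfolding deriv_x1 using pos sgn x2
    by (simp add: diff_divide_distrib power2_eq_square)
  then have "S x * deriv f (x - 1) \<le> S x * (deriv R (x - 1) + deriv S (x - 1) / f (x - 2))"
    using sgn by (intro mult_left_mono)
  also have "\<dots> \<le> f (x - 1) * (deriv R x * f (x - 1) + deriv S x)"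
    using assms(7)[of "x - 1"] assms(7)[of "x - 2"] assms(9)[of n x] sgn x n \<open>n \<ge> n\<^sub>0 + 2\<close>
    by (intro le_divide_of_lower_bounds[of "m (x - 1)" _ "m (x - 2)" _ "M (x - 2)"]) auto
  \<comment> \<open>Multiplying \<open>deriv_x\<close> by the positive number
    \<open>(f (x - 1))\<^sup>2\<close> turns the claim into the inequality just obtained.\<close>
  finally have "deriv f x \<ge> 0"
    unfolding deriv_x using pos by (simp add: field_simps power2_eq_square)
  moreover have "f differentiable (at x)"
    using diff[of n x] x \<open>n \<ge> n\<^sub>0 + 2\<close> by simp
  ultimately show "f differentiable (at x) \<and> deriv f x \<ge> 0"
    by blast
qed

end
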